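(* Let $m,n \geq 1$ be integers. There exist constants $C_1, C_2, c, C_3 > 0$ depending only on $m,n$, and for every real $N>0$ a constant $C_N > 0$ depending only on $N$ and $m,n$, such that the following holds. Let $\theta \in \mathbb{R}^m$, let $q = (q_1,\ldots,q_n) \in \mathbb{Z}^n$ with $q \neq 0$, let $0 < \delta < 1/2$, and let $\mu$ be a Borel probability measure on $[0,1]^{mn}$. Then $$\mu(L^m_{\delta,q,\theta}) \leq C_1\, \delta^m \Big(1 + C_2 \sum_{t \in \mathbb{Z}^m,\ 0<|t|\leq 2/\delta} |\widehat{\mu}(tq^T)| \Big),$$ and, for all $K>0$ and $N>0$, $$\mu(L^m_{\delta,q,\theta}) \geq c\,\delta^m \Big(1 - C_3 \sum_{t \in \mathbb{Z}^m,\ 0<|t|\leq K/\delta} |\widehat{\mu}(tq^T)| \Big) - C_N K^{-N}.$$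
   Context: $|\cdot|$ denotes the max norm. For $\theta = (\theta_1,\ldots,\theta_m) \in \mathbb{R}^m$, nonzero $q \in \mathbb{Z}^n$ and $\delta \geq 0$, define $$L_{\delta,q,\theta_i} = \{x \in \mathbb{R}^n : \exists r \in \mathbb{Z},\ |q_1x_1 + \cdots + q_nx_n - r - \theta_i| \leq \delta\},$$ $$L^m_{\delta,q,\theta} = L_{\delta,q,\theta_1} \times \cdots \times L_{\delta,q,\theta_m} \subset \mathbb{R}^{mn}.$$ For $t \in \mathbb{Z}^m$, $tq^T$ denotes the point $(t_1q_1,\ldots,t_1q_n,\ldots,t_mq_1,\ldots,t_mq_n) \in \mathbb{R}^{mn}$. The Fourier transform is $\widehat{\mu}(\xi) = \int e^{-2\pi i x\cdot\xi}\,d\mu(x)$ for $\xi\in\mathbb{R}^{mn}$. *)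

theory Defs
  imports "HOL-Probability.Probability"
begin

text \<open>
  A point of \<open>\<real>\<^sup>m\<^sup>n\<close> is rendered as \<open>x :: real ^ 'n ^ 'm\<close>, so that \<open>x $ i\<close> is its
  \<open>i\<close>-th block in \<open>\<real>\<^sup>n\<close>, with \<open>m = CARD('m)\<close> and \<open>n = CARD('n)\<close>. The inner product on this
  type is the usual dot product of the \<open>m n\<close> coordinates.
\<close>

definition real_vec :: "int ^ 'k \<Rightarrow> real ^ 'k"
  where "real_vec t = (\<chi> i. real_of_int (t $ i))"

definition L :: "real \<Rightarrow> int ^ 'n \<Rightarrow> real \<Rightarrow> (real ^ 'n) set"
  where "L \<delta> q \<alpha> =
    {x. \<exists>r::int. \<bar>(\<Sum>j\<in>UNIV. real_of_int (q $ j) * x $ j) - real_of_int r - \<alpha>\<bar> \<le> \<delta>}"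

definition Lm :: "real \<Rightarrow> int ^ 'n \<Rightarrow> real ^ 'm \<Rightarrow> (real ^ 'n ^ 'm) set"
  where "Lm \<delta> q \<theta> = {x. \<forall>i. x $ i \<in> L \<delta> q (\<theta> $ i)}"

definition outer :: "int ^ 'm \<Rightarrow> int ^ 'n \<Rightarrow> real ^ 'n ^ 'm"
  where "outer t q = (\<chi> i j. real_of_int (t $ i * q $ j))"

definition fourier :: "'a::euclidean_space measure \<Rightarrow> 'a \<Rightarrow> complex"
  where "fourier M \<xi> = (LINT x|M. exp (- 2 * complex_of_real pi * \<i> * complex_of_real (x \<bullet> \<xi>)))"

text \<open>The library's \<^const>\<open>infnorm\<close> is the max norm.\<close>

definition freqs :: "real \<Rightarrow> (int ^ 'm) set"
  where "freqs R = {t. 0 < infnorm (real_vec t) \<and> infnorm (real_vec t) \<le> R}"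

text \<open>Sums over \<^const>\<open>freqs\<close> are genuine finite sums:\<close>

lemma finite_freqs: "finite (freqs R :: (int ^ 'm) set)"
proof (rule finite_subset)
  let ?B = "{-\<lceil>R\<rceil>..\<lceil>R\<rceil>}"
  show "freqs R \<subseteq> (\<lambda>f. \<chi> i. f i) ` (UNIV \<rightarrow>\<^sub>E ?B :: ('m \<Rightarrow> int) set)"
  proof
    fix t :: "int ^ 'm"
    assume "t \<in> freqs R"
    then have R: "infnorm (real_vec t) \<le> R"
      by (simp add: freqs_def)
    have "t $ i \<in> ?B" for i
    proof -
      have "\<bar>real_of_int (t $ i)\<bar> \<le> R"
        using component_le_infnorm_cart[of "real_vec t" i] R by (simp add: real_vec_def)
      then show ?thesis
        by (simp, linarith)
    qed
    then have "($) t \<in> (UNIV \<rightarrow>\<^sub>E ?B)"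
      by auto
    moreover have "t = (\<chi> i. t $ i)"
      by simp
    ultimately show "t \<in> (\<lambda>f. \<chi> i. f i) ` (UNIV \<rightarrow>\<^sub>E ?B)"
      by blast
  qed
  show "finite ((\<lambda>f. \<chi> i. f i) ` (UNIV \<rightarrow>\<^sub>E ?B :: ('m \<Rightarrow> int) set))"
    by (intro finite_imageI finite_PiE) auto
qed

text \<open>Borel probability measures on \<open>[0,1]\<^sup>m\<^sup>n\<close>, as Borel measures on the whole space
  that give the cube full mass.\<close>

definition prob_on_unit_cube :: "(real ^ 'n ^ 'm) measure \<Rightarrow> bool"
  where "prob_on_unit_cube M \<longleftrightarrow>
    prob_space M \<and> sets M = sets borel \<and>
    measure M {x. \<forall>i j. 0 \<le> x $ i $ j \<and> x $ i $ j \<le> 1} = 1"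

end

theory Submission
  imports Defs
begin

text \<open>
  Membership of \<open>x\<close> in \<^const>\<open>Lm\<close> says that each of the \<open>m\<close> phases \<open>q \<cdot> x\<^sub>i - \<theta>\<^sub>i\<close> lies within
  \<open>\<delta>\<close> of an integer. If a trigonometric polynomial \<open>f \<ge> 0\<close> of degree at most \<open>R\<close> has mean \<open>a\<close>, all
  its coefficients are at most \<open>a\<close>, so the \<open>\<mu>\<close>-integral of the product of \<open>f\<close> over the phases is
  \<open>a\<^sup>m\<close> up to an error of \<open>a\<^sup>m\<close> times the sum of \<open>\<bar>\<mu>^(tq\<^sup>T)\<bar>\<close> over \<open>0 < \<bar>t\<bar> \<le> R\<close>.

  For the upper bound take for \<open>f\<close> a Fejer kernel \<open>\<bar>D\<^sub>M\<bar>\<^sup>2\<close> with \<open>M\<close> of order \<open>1/\<delta>\<close>. For the lower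
  bound, the normalized kernel \<open>\<bar>D\<^sub>M\<bar>\<^sup>2\<^sup>k\<close> with \<open>M\<close> of order \<open>K/(k\<delta>)\<close>, averaged over translates by an
  interval of length \<open>\<delta>/2\<close>, gives a trigonometric polynomial of degree at most \<open>K/\<delta>\<close> with values
  in \<open>[0,1]\<close> and mean of order \<open>\<delta>\<close> which is \<open>O\<^sub>k(K\<^sup>1\<^sup>-\<^sup>2\<^sup>k)\<close> at distance more than \<open>\<delta>\<close> from the
  integers. Here \<open>k\<close> is chosen in terms of \<open>N\<close>. Averages over \<open>P\<close>-th parts of the unit interval
  with \<open>P\<close> large replace integrals throughout.
\<close>

section \<open>The additive character e(x) = exp(2 pi i x) and its distance from 1\<close>

definition echar :: "real \<Rightarrow> complex"
  where "echar x = cis (2 * pi * x)"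

lemma norm_echar [simp]: "cmod (echar x) = 1"
  by (simp add: echar_def)

lemma echar_0 [simp]: "echar 0 = 1"
  by (simp add: echar_def)

lemma echar_add: "echar (x + y) = echar x * echar y"
  by (simp add: echar_def cis_mult algebra_simps)

lemma cnj_echar: "cnj (echar x) = echar (- x)"
  by (simp add: echar_def cis_cnj)

lemma echar_of_int [simp]: "echar (of_int r) = 1"
  by (simp add: echar_def)

lemma echar_power: "echar x ^ n = echar (of_nat n * x)"
  unfolding echar_def Complex.DeMoivre by (rule arg_cong[where f = cis]) simp

lemma echar_sum: "echar (\<Sum>i\<in>A. g i) = (\<Prod>i\<in>A. echar (g i))"
  by (induction A rule: infinite_finite_induct) (auto simp: echar_add)

lemma echar_eq_1_imp: "echar x = 1 \<Longrightarrow> x \<in> \<int>"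
  by (auto simp: echar_def complex_eq_iff cos_one_2pi_int)

lemma continuous_on_echar [continuous_intros]:
  "continuous_on A f \<Longrightarrow> continuous_on A (\<lambda>x. echar (f x))"
  unfolding echar_def by (intro continuous_intros)

text \<open>The cubic Taylor bound gives sin x >= x - x^3/6 >= x/2 on [0, 8/5], an interval
  containing [0, pi/2]; with x = pi u this exceeds u because pi > 2.\<close>

lemma le_sin_pi_mult:
  fixes u :: real
  assumes "0 \<le> u" "u \<le> 1/2"
  shows "u \<le> sin (pi * u)"
proof -
  define x where "x = pi * u"
  have x: "0 \<le> x" "x \<le> 8/5"
    using assms mult_mono[of pi "16/5" u "1/2"] pi_approx by (auto simp: x_def)
  have "\<bar>sin x - x\<bar> \<le> x ^ 3 / 6"
    using Maclaurin_sin_bound[of x 3] x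
    by (simp add: sin_coeff_def eval_nat_numeral)
  then have "x - x ^ 3 / 6 \<le> sin x" by linarith
  moreover have "x ^ 3 \<le> x * (64/25)"
    using mult_left_mono[OF power_mono[OF x(2,1), of 2] x(1)] by (simp add: eval_nat_numeral)
  ultimately have "x / 2 \<le> sin x" using x by linarith
  moreover have "2 * u \<le> x"
    using mult_right_mono[of 2 pi u] pi_gt3 assms by (simp add: x_def)
  ultimately show ?thesis by (simp add: x_def)
qed

lemma norm_echar_minus_1: "cmod (echar x - 1) = 2 * \<bar>sin (pi * x)\<bar>"
proof -
  have "(cmod (echar x - 1))\<^sup>2 = (cos (2 * (pi * x)) - 1)\<^sup>2 + (sin (2 * (pi * x)))\<^sup>2"
    by (simp add: echar_def cmod_def mult.assoc)
  also have "\<dots> = 2 - 2 * cos (2 * (pi * x))"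
    using sin_cos_squared_add[of "2 * (pi * x)"] by (simp add: power2_eq_square algebra_simps)
  also have "\<dots> = (2 * \<bar>sin (pi * x)\<bar>)\<^sup>2"
    by (simp add: cos_double_sin power2_eq_square)
  finally show ?thesis
    by (smt (verit) power2_eq_imp_eq norm_ge_zero)
qed

text \<open>Subtracting the nearest integer leaves \<open>echar x\<close> unchanged and moves x into
  [-1/2, 1/2], where the linear lower bound for the sine applies.\<close>

lemma norm_echar_minus_1_ge:
  assumes "\<And>r::int. \<eta> \<le> \<bar>x - of_int r\<bar>"
  shows "2 * \<eta> \<le> cmod (echar x - 1)"
proof -
  define u where "u = x - of_int (round x)"
  have u: "\<bar>u\<bar> \<le> 1/2" "\<eta> \<le> \<bar>u\<bar>"
    using of_int_round_abs_le[of x] assms[of "round x"] unfolding u_def by linarith+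
  have "echar x = echar u"
    using echar_add[of u "of_int (round x)"] by (simp add: u_def)
  then have "cmod (echar x - 1) = 2 * \<bar>sin (pi * \<bar>u\<bar>)\<bar>"
    by (cases "u \<ge> 0") (auto simp: norm_echar_minus_1)
  moreover have "\<bar>u\<bar> \<le> sin (pi * \<bar>u\<bar>)"
    by (rule le_sin_pi_mult) (use u in auto)
  ultimately show ?thesis using u by linarith
qed

text \<open>As 0 < |t| < P, the integer P does not divide t, so e(t/P) is a nontrivial P-th root of
  unity and its geometric sum vanishes.\<close>

lemma sum_echar_roots:
  assumes "t \<noteq> 0" "\<bar>t\<bar> < int P"
  shows "(\<Sum>j<P. echar (of_int t * (of_nat j / of_nat P))) = 0"
proof -
  have P: "P > 0" using assms by linarith
  define z where "z = echar (of_int t / of_nat P)"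
  have "z \<noteq> 1"
  proof
    assume "z = 1"
    then obtain r :: int where "of_int t / real P = of_int r"
      using echar_eq_1_imp by (auto simp: z_def Ints_def)
    then have "real_of_int t = of_int (r * int P)" using P by (simp add: field_simps)
    then have "t = r * int P" by linarith
    then show False using assms P
      by (metis dvd_imp_le_int dvd_triv_right abs_of_nat leD)
  qed
  moreover have "z ^ P = 1"
    using P by (simp add: z_def echar_power)
  ultimately have "(\<Sum>j<P. z ^ j) = 0"
    by (simp add: geometric_sum)
  then show ?thesis
    by (simp add: z_def echar_power mult.commute)
qed

section \<open>Trigonometric polynomials and their discrete means\<close>

text \<open>The sign of the frequencies is that of \<^const>\<open>fourier\<close>.\<close>

definition has_spectrum :: "(real \<Rightarrow> complex) \<Rightarrow> nat \<Rightarrow> (int \<Rightarrow> complex) \<Rightarrow> bool"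
  where "has_spectrum F d b \<longleftrightarrow>
    (\<forall>y. F y = (\<Sum>t\<in>{- int d..int d}. b t * echar (- (of_int t * y))))"

lemma has_spectrumD:
  "has_spectrum F d b \<Longrightarrow> F y = (\<Sum>t\<in>{- int d..int d}. b t * echar (- (of_int t * y)))"
  by (simp add: has_spectrum_def)

text \<open>Collects terms of equal frequency, so that double sums, as they arise from products and
  from squared moduli, can be read as trigonometric polynomials.\<close>

lemma has_spectrum_group:
  assumes "finite I" "\<tau> ` I \<subseteq> {- int d..int d}"
  shows "has_spectrum (\<lambda>y. \<Sum>i\<in>I. w i * echar (- (of_int (\<tau> i) * y))) d
    (\<lambda>t. \<Sum>i\<in>{i \<in> I. \<tau> i = t}. w i)"
  unfolding has_spectrum_def
proof
  fix y
  have "(\<Sum>i\<in>I. w i * echar (- (of_int (\<tau> i) * y)))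
    = (\<Sum>t\<in>{- int d..int d}. \<Sum>i\<in>{i \<in> I. \<tau> i = t}. w i * echar (- (of_int (\<tau> i) * y)))"
    using assms by (subst sum.group) auto
  also have "\<dots> = (\<Sum>t\<in>{- int d..int d}. (\<Sum>i\<in>{i \<in> I. \<tau> i = t}. w i) * echar (- (of_int t * y)))"
    by (intro sum.cong refl) (auto simp: sum_distrib_right)
  finally show "(\<Sum>i\<in>I. w i * echar (- (of_int (\<tau> i) * y)))
    = (\<Sum>t\<in>{- int d..int d}. (\<Sum>i\<in>{i \<in> I. \<tau> i = t}. w i) * echar (- (of_int t * y)))" .
qed

lemma has_spectrum_mult:
  assumes "has_spectrum F d b" "has_spectrum G d' b'"
  shows "\<exists>c. has_spectrum (\<lambda>y. F y * G y) (d + d') c"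
proof -
  let ?S = "{- int d..int d} \<times> {- int d'..int d'}"
  have "(\<lambda>y. F y * G y) = (\<lambda>y. \<Sum>p\<in>?S. (b (fst p) * b' (snd p)) * echar (- (of_int (fst p + snd p) * y)))"
    using assms[THEN has_spectrumD]
    by (auto simp: sum_product sum.cartesian_product echar_add[symmetric] algebra_simps
        intro!: ext sum.cong)
  moreover have "(\<lambda>p. fst p + snd p) ` ?S \<subseteq> {- int (d + d')..int (d + d')}" by auto
  ultimately show ?thesis
    using has_spectrum_group[of ?S "\<lambda>p. fst p + snd p" "d + d'" "\<lambda>p. b (fst p) * b' (snd p)"]
    by auto
qed

lemma has_spectrum_power:
  assumes "has_spectrum F d b"
  shows "\<exists>c. has_spectrum (\<lambda>y. F y ^ k) (k * d) c"
proof (induction k)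
  case 0
  show ?case by (rule exI[of _ "\<lambda>_. 1"]) (simp add: has_spectrum_def)
next
  case (Suc k)
  then show ?case using has_spectrum_mult[OF assms] by auto
qed

text \<open>Discrete orthogonality: the frequency differences t - s are at most 2d < P in modulus,
  so every one except s = t averages to 0. The sum over P equally spaced points thus extracts a
  Fourier coefficient exactly, from any starting point y.\<close>

lemma spectrum_mean:
  assumes F: "has_spectrum F d b" and t: "\<bar>t\<bar> \<le> int d" and P: "2 * d < P"
  shows "(\<Sum>j<P. F (y + of_nat j / of_nat P) * echar (of_int t * (y + of_nat j / of_nat P))) = of_nat P * b t"
proof -
  let ?z = "\<lambda>j. y + real j / real P"
  have "(\<Sum>j<P. F (?z j) * echar (of_int t * ?z j))
    = (\<Sum>j<P. \<Sum>s\<in>{- int d..int d}. b s * echar (of_int (t - s) * ?z j))"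
  proof (rule sum.cong[OF refl])
    fix j
    show "F (?z j) * echar (of_int t * ?z j) = (\<Sum>s\<in>{- int d..int d}. b s * echar (of_int (t - s) * ?z j))"
      unfolding has_spectrumD[OF F] sum_distrib_right mult.assoc echar_add[symmetric]
      by (simp add: left_diff_distrib)
  qed
  also have "\<dots> = (\<Sum>s\<in>{- int d..int d}. b s * echar (of_int (t - s) * y) *
      (\<Sum>j<P. echar (of_int (t - s) * (real j / real P))))"
    by (subst sum.swap) (simp add: sum_distrib_left mult.assoc echar_add[symmetric] algebra_simps)
  also have "\<dots> = (\<Sum>s\<in>{- int d..int d}. if s = t then of_nat P * b t else 0)"
  proof (intro sum.cong refl)
    fix s assume s: "s \<in> {- int d..int d}"
    show "b s * echar (of_int (t - s) * y) * (\<Sum>j<P. echar (of_int (t - s) * (real j / real P)))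
      = (if s = t then of_nat P * b t else 0)"
    proof (cases "s = t")
      case False
      moreover have "\<bar>t - s\<bar> < int P" using s t P by auto
      ultimately show ?thesis using sum_echar_roots[of "t - s" P] by simp
    qed simp
  qed
  also have "\<dots> = of_nat P * b t" using t by (simp add: sum.delta abs_le_iff minus_le_iff)
  finally show ?thesis .
qed

text \<open>For f >= 0 the triangle inequality in the discrete mean that gives b t bounds |b t| by
  the mean of f itself, which is b 0. That the mean does not depend on y or P is used later to
  normalize kernels.\<close>

lemma spectrum_nonneg:
  assumes F: "has_spectrum (\<lambda>y. of_real (f y)) d b" and nn: "\<And>y. 0 \<le> f y"
  obtains a where "b 0 = of_real a" "\<And>t. \<bar>t\<bar> \<le> int d \<Longrightarrow> cmod (b t) \<le> a"
    "\<And>P y. 2 * d < P \<Longrightarrow> (\<Sum>j<P. f (y + of_nat j / of_nat P)) = of_nat P * a"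
proof -
  have mean: "of_real (\<Sum>j<P. f (y + of_nat j / of_nat P)) = of_nat P * b 0" if "2 * d < P" for P y
    using spectrum_mean[OF F, of 0 P y] that by simp
  define P where "P = 2 * d + 1"
  define a where "a = (\<Sum>j<P. f (of_nat j / of_nat P)) / of_nat P"
  have P: "2 * d < P" by (simp add: P_def)
  have b0: "b 0 = of_real a"
    using mean[OF P, of 0] P unfolding a_def by (simp add: field_simps)
  show thesis
  proof
    show "b 0 = of_real a" by (fact b0)
    show "(\<Sum>j<P. f (y + of_nat j / of_nat P)) = of_nat P * a" if "2 * d < P" for P y
      using mean[OF that, of y] unfolding b0 by (metis of_real_eq_iff of_real_mult of_real_of_nat_eq)
    show "cmod (b t) \<le> a" if "\<bar>t\<bar> \<le> int d" for t
    proof -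
      have "real P * cmod (b t) = cmod (of_nat P * b t)" by (simp add: norm_mult)
      also have "\<dots> \<le> (\<Sum>j<P. f (real j / real P))"
        unfolding spectrum_mean[OF F that P, of 0, symmetric]
        by (rule order.trans[OF norm_sum]) (simp add: norm_mult nn)
      finally show ?thesis using P by (simp add: a_def field_simps)
    qed
  qed
qed

section \<open>Dirichlet and Fejer kernels\<close>

text \<open>The one-sided kernel: for M >= 1 its squared modulus is M times the usual Fejer kernel
  of mean 1.\<close>

definition dirichlet :: "nat \<Rightarrow> real \<Rightarrow> complex"
  where "dirichlet M y = (\<Sum>k<M. echar (of_nat k * y))"

text \<open>Expanding D times its conjugate gives one term for each pair of indices; the frequency 0
  comes from the M diagonal pairs.\<close>

lemma has_spectrum_fejer:
  obtains b where "has_spectrum (\<lambda>y. of_real ((cmod (dirichlet M y))\<^sup>2)) M b" "b 0 = of_nat M"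
proof -
  let ?I = "{..<M} \<times> {..<M}"
  let ?\<tau> = "\<lambda>p::nat \<times> nat. int (snd p) - int (fst p)"
  have "of_real ((cmod (dirichlet M y))\<^sup>2) = (\<Sum>p\<in>?I. 1 * echar (- (of_int (?\<tau> p) * y)))" for y
  proof -
    have "of_real ((cmod (dirichlet M y))\<^sup>2) = dirichlet M y * cnj (dirichlet M y)"
      by (rule complex_norm_square)
    also have "\<dots> = (\<Sum>p\<in>?I. 1 * echar (- (of_int (?\<tau> p) * y)))"
      by (auto simp: dirichlet_def sum_product sum.cartesian_product cnj_echar
        echar_add[symmetric] algebra_simps intro!: sum.cong)
    finally show ?thesis .
  qed
  moreover have "?\<tau> ` ?I \<subseteq> {- int M..int M}" by auto
  ultimately have "has_spectrum (\<lambda>y. of_real ((cmod (dirichlet M y))\<^sup>2)) M (\<lambda>t. \<Sum>i\<in>{i \<in> ?I. ?\<tau> i = t}. 1)"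
    using has_spectrum_group[of ?I ?\<tau> M "\<lambda>_. 1"] by simp
  moreover have "{i \<in> ?I. ?\<tau> i = 0} = (\<lambda>k. (k, k)) ` {..<M}" by auto
  then have "(\<Sum>i\<in>{i \<in> ?I. ?\<tau> i = 0}. 1) = (of_nat M :: complex)"
    by (simp add: card_image inj_on_def)
  ultimately show thesis by (rule that)
qed

text \<open>Modulo 1 every k y is within 1/8 of 0, so every term has argument at most pi/4 < pi/3
  and real part at least 1/2. The alternative M <= 1, where the only possible term is 1, serves the
  case of large \<open>\<delta>\<close> in the upper bound.\<close>

lemma dirichlet_ge:
  assumes "\<bar>y - of_int r\<bar> \<le> \<eta>" "real M * \<eta> \<le> 1/8 \<or> M \<le> 1"
  shows "real M / 2 \<le> cmod (dirichlet M y)"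
proof -
  define u where "u = y - of_int r"
  have "echar (of_nat k * y) = echar (of_nat k * u)" for k
    using echar_add[of "of_nat k * u" "of_int (int k * r)"]
    by (simp only: echar_of_int) (simp add: u_def algebra_simps)
  then have D: "dirichlet M y = (\<Sum>k<M. echar (of_nat k * u))" by (simp add: dirichlet_def)
  have "1/2 \<le> Re (echar (of_nat k * u))" if k: "k < M" for k
  proof -
    have "\<bar>real k * u\<bar> \<le> 1/8"
    proof (cases "M \<le> 1")
      case False
      have "\<bar>real k * u\<bar> \<le> real M * \<eta>"
        unfolding abs_mult using k assms(1) by (intro mult_mono) (auto simp: u_def)
      then show ?thesis using assms False by linarith
    next
      case True
      with k have "k = 0" by simp
      then show ?thesis by simp
    qed
    then have "2 * pi * \<bar>real k * u\<bar> \<le> 2 * pi * (1/8)" by (intro mult_left_mono) auto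
    then have "cos (pi / 3) \<le> cos (2 * pi * \<bar>real k * u\<bar>)"
      by (intro cos_monotone_0_pi_le) (auto simp: field_simps)
    also have "cos (2 * pi * \<bar>real k * u\<bar>) = cos \<bar>2 * pi * (real k * u)\<bar>"
      by (simp add: abs_mult)
    finally show ?thesis by (simp add: echar_def cos_60)
  qed
  then have "(\<Sum>k<M. 1/2) \<le> (\<Sum>k<M. Re (echar (of_nat k * u)))" by (intro sum_mono) auto
  also have "\<dots> = Re (dirichlet M y)" by (simp add: D)
  also have "\<dots> \<le> cmod (dirichlet M y)" by (rule complex_Re_le_cmod)
  finally show ?thesis by simp
qed

text \<open>In the closed form of the geometric sum the numerator is at most 2 and the denominator
  at least \<open>2 * \<eta>\<close>.\<close>

lemma dirichlet_le:
  assumes \<eta>: "0 < \<eta>" and y: "\<And>r::int. \<eta> \<le> \<bar>y - of_int r\<bar>"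
  shows "cmod (dirichlet M y) \<le> 1 / \<eta>"
proof -
  have *: "2 * \<eta> \<le> cmod (echar y - 1)" by (rule norm_echar_minus_1_ge[OF y])
  then have "echar y \<noteq> 1" using \<eta> by auto
  then have "dirichlet M y = (echar y ^ M - 1) / (echar y - 1)"
    using geometric_sum[of "echar y" M] by (simp add: dirichlet_def echar_power)
  then have "cmod (dirichlet M y) = cmod (echar y ^ M - 1) / cmod (echar y - 1)"
    by (simp add: norm_divide)
  also have "\<dots> \<le> 2 / (2 * \<eta>)"
    using norm_triangle_ineq4[of "echar y ^ M" 1] * \<eta>
    by (intro frac_le) (auto simp: norm_power)
  finally show ?thesis by simp
qed


section \<open>Products over the phases and their integrals\<close>

definition phase :: "int ^ 'n \<Rightarrow> real ^ 'm \<Rightarrow> real ^ 'n ^ 'm \<Rightarrow> 'm \<Rightarrow> real"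
  where "phase q \<theta> x i = (\<Sum>j\<in>UNIV. of_int (q $ j) * x $ i $ j) - \<theta> $ i"

definition cube :: "nat \<Rightarrow> (int ^ 'm) set"
  where "cube d = {t. \<forall>i. \<bar>t $ i\<bar> \<le> int d}"

lemma mem_Lm_iff: "x \<in> Lm \<delta> q \<theta> \<longleftrightarrow> (\<forall>i. \<exists>r::int. \<bar>phase q \<theta> x i - of_int r\<bar> \<le> \<delta>)"
  by (simp add: Lm_def L_def phase_def algebra_simps)

lemma phase_measurable [measurable]:
  "(\<lambda>x. phase q \<theta> x i) \<in> borel_measurable borel"
  unfolding phase_def by (intro borel_measurable_continuous_onI continuous_intros)

lemma Lm_borel: "Lm \<delta> q \<theta> \<in> sets borel"
proof -
  have "Lm \<delta> q \<theta> = {x \<in> space borel. \<forall>i. \<exists>r::int. \<bar>phase q \<theta> x i - of_int r\<bar> \<le> \<delta>}"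
    by (auto simp: mem_Lm_iff)
  also have "\<dots> \<in> sets borel" by measurable
  finally show ?thesis .
qed

lemma cube_conv_freqs: "cube d = insert 0 (freqs (real d))"
proof -
  have "infnorm (real_vec t) \<le> real d \<longleftrightarrow> t \<in> cube d" for t :: "int ^ 'a"
  proof
    assume *: "infnorm (real_vec t) \<le> real d"
    have "\<bar>real_of_int (t $ i)\<bar> \<le> real d" for i
      using component_le_infnorm_cart[of "real_vec t" i] * by (simp add: real_vec_def)
    then have "\<bar>t $ i\<bar> \<le> int d" for i
      by (metis of_int_abs of_int_le_iff of_int_of_nat_eq)
    then show "t \<in> cube d" by (simp add: cube_def)
  next
    assume "t \<in> cube d"
    then have "\<bar>real_of_int (t $ i)\<bar> \<le> real d" for i
      unfolding cube_def by (simp, metis of_int_abs of_int_le_iff of_int_of_nat_eq)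
    then show "infnorm (real_vec t) \<le> real d"
      unfolding infnorm_cart by (intro cSup_least) (auto simp: real_vec_def)
  qed
  moreover have "0 < infnorm (real_vec t) \<longleftrightarrow> t \<noteq> 0" for t :: "int ^ 'a"
    by (simp add: infnorm_pos_lt real_vec_def vec_eq_iff)
  moreover have "(0 :: int ^ 'a) \<in> cube d" by (simp add: cube_def)
  ultimately show ?thesis by (auto simp: freqs_def)
qed

text \<open>The product of m sums expands into a sum over choices of one frequency per factor, and
  these choices are the integer vectors in the cube.\<close>

lemma prod_spectrum:
  fixes y :: "'m::finite \<Rightarrow> real"
  assumes F: "has_spectrum F d b"
  shows "(\<Prod>i\<in>UNIV. F (y i)) =
    (\<Sum>t\<in>(cube d :: (int ^ 'm) set). (\<Prod>i\<in>UNIV. b (t $ i)) * echar (- (\<Sum>i\<in>UNIV. of_int (t $ i) * y i)))"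
proof -
  let ?S = "UNIV \<rightarrow>\<^sub>E {- int d..int d} :: ('m \<Rightarrow> int) set"
  have bij: "bij_betw (\<lambda>t::int ^ 'm. ($) t) (cube d) ?S"
  proof (rule bij_betw_byWitness[where f' = "\<lambda>g. \<chi> i. g i"])
    show "(\<lambda>t::int ^ 'm. ($) t) ` cube d \<subseteq> ?S"
      by (auto simp: cube_def abs_le_iff minus_le_iff)
    show "(\<lambda>g. \<chi> i. g i) ` ?S \<subseteq> cube d"
      by (auto simp: cube_def abs_le_iff minus_le_iff PiE_def Pi_def)
  qed auto
  have "(\<Prod>i\<in>UNIV. F (y i)) = (\<Sum>g\<in>?S. \<Prod>i\<in>UNIV. b (g i) * echar (- (of_int (g i) * y i)))"
    unfolding has_spectrumD[OF F] by (rule prod_sum_PiE) auto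
  also have "\<dots> = (\<Sum>t\<in>cube d. \<Prod>i\<in>UNIV. b (t $ i) * echar (- (of_int (t $ i) * y i)))"
    by (rule sum.reindex_bij_betw[OF bij, symmetric])
  finally show ?thesis
    by (simp add: prod.distrib echar_sum[symmetric] sum_negf)
qed

lemma fourier_eq: "fourier \<mu> \<xi> = (LINT x|\<mu>. echar (- (x \<bullet> \<xi>)))"
  unfolding fourier_def echar_def cis_conv_exp by (simp add: mult_ac)

text \<open>Here the points \<open>outer t q\<close> enter: combining the phases with weights
  \<open>t $ i\<close> gives the inner product of x with \<open>outer t q\<close>, up to a constant
  in \<open>\<theta>\<close> that contributes only a unimodular factor.\<close>

lemma echar_phase:
  "echar (- (\<Sum>i\<in>UNIV. of_int (t $ i) * phase q \<theta> x i))
    = echar (\<Sum>i\<in>UNIV. of_int (t $ i) * \<theta> $ i) * echar (- (x \<bullet> outer t q))"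
  by (simp add: echar_add[symmetric] phase_def outer_def inner_vec_def sum_distrib_left
      right_diff_distrib sum_subtractf mult_ac)

lemma integral_prod_spectrum:
  fixes \<mu> :: "(real ^ 'n ^ 'm) measure"
  assumes "prob_space \<mu>" and [measurable_cong]: "sets \<mu> = sets borel" and F: "has_spectrum F d b"
  shows "(LINT x|\<mu>. (\<Prod>i\<in>UNIV. F (phase q \<theta> x i))) =
    (\<Sum>t\<in>cube d. (\<Prod>i\<in>UNIV. b (t $ i)) * echar (\<Sum>i\<in>UNIV. of_int (t $ i) * \<theta> $ i) * fourier \<mu> (outer t q))"
proof -
  interpret prob_space \<mu> by fact
  have int: "integrable \<mu> (\<lambda>x. echar (- (x \<bullet> \<xi>)))" for \<xi>
  proof (rule integrable_const_bound[where B = 1])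
    have "(\<lambda>x. echar (- (x \<bullet> \<xi>))) \<in> borel_measurable borel"
      by (intro borel_measurable_continuous_onI continuous_intros)
    then show "(\<lambda>x. echar (- (x \<bullet> \<xi>))) \<in> borel_measurable \<mu>" by measurable
  qed auto
  show ?thesis
    unfolding prod_spectrum[OF F] echar_phase fourier_eq
    by (simp add: int mult.assoc[symmetric])
qed

text \<open>The term t = 0 is exactly \<open>a ^ CARD('m)\<close>, since \<mu> has total mass 1;
  each other coefficient is a product of m numbers of modulus at most a.\<close>

lemma integral_prod_approx:
  fixes \<mu> :: "(real ^ 'n ^ 'm) measure"
  assumes \<mu>: "prob_space \<mu>" "sets \<mu> = sets borel"
    and F: "has_spectrum (\<lambda>y. of_real (f y)) d b"
    and b0: "b 0 = of_real a" and b: "\<And>t. \<bar>t\<bar> \<le> int d \<Longrightarrow> cmod (b t) \<le> a" and d: "real d \<le> R"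
  shows "\<bar>(LINT x|\<mu>. (\<Prod>i\<in>UNIV. f (phase q \<theta> x i))) - a ^ CARD('m)\<bar>
    \<le> a ^ CARD('m) * (\<Sum>t\<in>freqs R. cmod (fourier \<mu> (outer t q)))"
proof -
  interpret prob_space \<mu> by fact
  have a: "0 \<le> a" using order_trans[OF norm_ge_zero b[of 0]] by simp
  define c where "c t = (\<Prod>i\<in>UNIV. b (t $ i)) * echar (\<Sum>i\<in>UNIV. of_int (t $ i) * \<theta> $ i) * fourier \<mu> (outer t q)" for t
  have fr: "fourier \<mu> (outer 0 q) = 1"
  proof -
    have "outer (0 :: int ^ 'm) q = 0" by (simp add: outer_def vec_eq_iff)
    then show ?thesis by (simp add: fourier_eq prob_space)
  qed
  have z: "(0 :: int ^ 'm) \<notin> freqs r" for r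
  proof -
    have "real_vec (0 :: int ^ 'm) = 0" by (simp add: real_vec_def vec_eq_iff)
    then show ?thesis by (simp add: freqs_def infnorm_0)
  qed
  have "of_real (LINT x|\<mu>. (\<Prod>i\<in>UNIV. f (phase q \<theta> x i))) = sum c (cube d)"
    using integral_prod_spectrum[OF \<mu> F, of q \<theta>]
    unfolding c_def of_real_prod[symmetric] integral_complex_of_real by simp
  also have "\<dots> = of_real (a ^ CARD('m)) + sum c (freqs (real d))"
    by (simp add: cube_conv_freqs finite_freqs z) (simp add: c_def fr b0)
  finally have "complex_of_real ((LINT x|\<mu>. (\<Prod>i\<in>UNIV. f (phase q \<theta> x i))) - a ^ CARD('m)) = sum c (freqs (real d))"
    by simp
  then have "\<bar>(LINT x|\<mu>. (\<Prod>i\<in>UNIV. f (phase q \<theta> x i))) - a ^ CARD('m)\<bar> = cmod (sum c (freqs (real d)))"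
    by (metis norm_of_real)
  also have "\<dots> \<le> (\<Sum>t\<in>freqs (real d). a ^ CARD('m) * cmod (fourier \<mu> (outer t q)))"
  proof (rule sum_norm_le)
    fix t :: "int ^ 'm" assume "t \<in> freqs (real d)"
    then have "t \<in> cube d" by (simp add: cube_conv_freqs)
    then have "(\<Prod>i\<in>UNIV. cmod (b (t $ i))) \<le> (\<Prod>i\<in>(UNIV::'m set). a)"
      by (intro prod_mono) (auto simp: cube_def b)
    then show "cmod (c t) \<le> a ^ CARD('m) * cmod (fourier \<mu> (outer t q))"
      by (simp add: c_def norm_mult prod_norm[symmetric] mult_right_mono)
  qed
  \<comment> \<open>All summands are nonnegative, so the range of frequencies may be enlarged from d
    to R.\<close>
  also have "\<dots> \<le> (\<Sum>t\<in>freqs R. a ^ CARD('m) * cmod (fourier \<mu> (outer t q)))"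
    by (rule sum_mono2) (use d a in \<open>auto simp: freqs_def finite_freqs[unfolded freqs_def]\<close>)
  finally show ?thesis by (simp add: sum_distrib_left)
qed

section \<open>A trigonometric substitute for the indicator of an interval\<close>

text \<open>f is F = |D|^(2k), divided by its full sum over P points, summed over a window of W
  consecutive points. A window is part of a full period, so f <= 1; the mean is W/P; and far from
  the integers every point of the window still lies where D is small.\<close>

lemma smoothed_interval:
  fixes \<delta> :: real
  assumes \<delta>: "0 < \<delta>" "\<delta> < 1" and M: "1 \<le> M"
  obtains f :: "real \<Rightarrow> real" and b a where
    "has_spectrum (\<lambda>y. of_real (f y)) (k * M) b" "b 0 = of_real a"
    "\<And>t. \<bar>t\<bar> \<le> int (k * M) \<Longrightarrow> cmod (b t) \<le> a" "\<delta> / 2 \<le> a"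
    "\<And>y. 0 \<le> f y" "\<And>y. f y \<le> 1"
    "\<And>y. (\<And>r::int. \<delta> < \<bar>y - of_int r\<bar>) \<Longrightarrow> f y \<le> 8 * (\<delta> * M) * (16 / (\<delta> * M)\<^sup>2) ^ k"
proof -
  define F where "F y = ((cmod (dirichlet M y))\<^sup>2) ^ k" for y
  have F0: "0 \<le> F y" for y by (simp add: F_def)
  obtain B where B: "has_spectrum (\<lambda>y. of_real (F y)) (k * M) B"
  proof -
    obtain b where "has_spectrum (\<lambda>y. of_real ((cmod (dirichlet M y))\<^sup>2)) M b"
      by (rule has_spectrum_fejer)
    from has_spectrum_power[OF this, of k] show thesis
      using that by (auto simp: F_def)
  qed
  obtain \<beta> where \<beta>: "B 0 = of_real \<beta>" "\<And>t. \<bar>t\<bar> \<le> int (k * M) \<Longrightarrow> cmod (B t) \<le> \<beta>"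
    "\<And>P y. 2 * (k * M) < P \<Longrightarrow> (\<Sum>j<P. F (y + of_nat j / of_nat P)) = of_nat P * \<beta>"
    using spectrum_nonneg[OF B F0] by metis
  \<comment> \<open>With P = 8Ms, the s points j/P with j < s lie within 1/(8M) of 0, where |D| >=
    M/2. Taking s > k ensures P > 2kM, so discrete means are exact; s >= \<open>2 / \<delta>\<close>
    makes P fine enough that rounding the window length costs little.\<close>
  define s where "s = Suc k + nat \<lceil>2 / \<delta>\<rceil>"
  define P where "P = 8 * M * s"
  have s: "0 < s" "k < s" "2 / \<delta> \<le> real s" by (auto simp: s_def, linarith)
  have "k * M < s * M" using s M by simp
  then have P: "2 * (k * M) < P" by (simp add: P_def)
  then have P0: "0 < P" by linarith
  have "real s \<le> real P" using M mult_le_mono1[of 1 "8 * M" s] unfolding P_def of_nat_le_iff by linarith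
  then have "2 / \<delta> \<le> real P" using s by linarith
  then have P\<delta>: "2 \<le> \<delta> * P" using \<delta> by (simp add: field_simps)
  \<comment> \<open>Lower bound for the mean \<beta> of F: keeping only the s points near 0, a
    proportion 1/(8M) of all points, gives \<beta> >= (M/2)^(2k) / (8M).\<close>
  have "real s * ((real M / 2)\<^sup>2) ^ k = (\<Sum>j<s. ((real M / 2)\<^sup>2) ^ k)" by simp
  also have "\<dots> \<le> (\<Sum>j<s. F (0 + of_nat j / of_nat P))"
  proof (rule sum_mono)
    fix j assume j: "j \<in> {..<s}"
    have "real M / 2 \<le> cmod (dirichlet M (0 + of_nat j / of_nat P))"
    proof (rule dirichlet_ge[where r = 0 and \<eta> = "1 / (8 * M)"])
      show "\<bar>0 + real j / real P - of_int 0\<bar> \<le> 1 / (8 * M)"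
        using j M s by (simp add: P_def field_simps)
    qed (use M in auto)
    then show "((real M / 2)\<^sup>2) ^ k \<le> F (0 + of_nat j / of_nat P)"
      unfolding F_def by (intro power_mono) auto
  qed
  also have "\<dots> \<le> (\<Sum>j<P. F (0 + of_nat j / of_nat P))"
    by (rule sum_mono2) (use M in \<open>auto simp: P_def F0\<close>)
  also have "\<dots> = of_nat P * \<beta>" by (rule \<beta>(3)[OF P])
  finally have "real s * ((real M / 2)\<^sup>2) ^ k \<le> real s * (8 * real M * \<beta>)" by (simp add: P_def mult_ac)
  then have \<beta>_ge: "((real M / 2)\<^sup>2) ^ k \<le> 8 * real M * \<beta>" using s by simp
  moreover have "0 < ((real M / 2)\<^sup>2) ^ k" using M by simp
  ultimately have "0 < 8 * real M * \<beta>" by linarith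
  then have \<beta>_pos: "0 < \<beta>" using M by (simp add: zero_less_mult_iff)
  \<comment> \<open>The window consists of the shifts j/P in \<open>[0, \<delta>/2]\<close>.
    Counting j = 0 gives W >= \<open>\<delta> * P / 2\<close>, hence mean at least
    \<open>\<delta>/2\<close>, while the largest shift is still at most
    \<open>\<delta>/2\<close>.\<close>
  define W where "W = Suc (nat \<lfloor>\<delta> * P / 2\<rfloor>)"
  have W: "\<delta> * P / 2 \<le> W" "real W \<le> \<delta> * P / 2 + 1"
    using P\<delta> unfolding W_def by linarith+
  then have W': "real W \<le> \<delta> * P" using P\<delta> by linarith
  also have "\<dots> < P" using \<delta> P0 by simp
  finally have WP: "W < P" by simp
  define a where "a = real W / real P"
  define f where "f y = (\<Sum>j<W. F (y + of_nat j / of_nat P)) / (of_nat P * \<beta>)" for y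
  \<comment> \<open>Translation by j/P multiplies the coefficient at t by a unimodular factor, so |b
    t| <= W \<beta> / (P \<beta>) = a.\<close>
  define b where "b t = (\<Sum>j<W. B t * echar (- (of_int t * (of_nat j / of_nat P)))) / of_real (of_nat P * \<beta>)" for t
  show thesis
  proof
    show "has_spectrum (\<lambda>y. of_real (f y)) (k * M) b"
      unfolding has_spectrum_def
    proof
      fix y
      have "complex_of_real (f y) = (\<Sum>j<W. complex_of_real (F (y + of_nat j / of_nat P))) / of_real (of_nat P * \<beta>)"
        by (simp add: f_def)
      also have "(\<Sum>j<W. complex_of_real (F (y + of_nat j / of_nat P)))
        = (\<Sum>j<W. \<Sum>t\<in>{- int (k * M)..int (k * M)}. B t * echar (- (of_int t * (of_nat j / of_nat P))) * echar (- (of_int t * y)))"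
        unfolding has_spectrumD[OF B] mult.assoc echar_add[symmetric] by (simp add: algebra_simps)
      also have "\<dots> = (\<Sum>t\<in>{- int (k * M)..int (k * M)}. (\<Sum>j<W. B t * echar (- (of_int t * (of_nat j / of_nat P)))) * echar (- (of_int t * y)))"
        unfolding sum_distrib_right by (rule sum.swap)
      finally show "of_real (f y) = (\<Sum>t\<in>{- int (k * M)..int (k * M)}. b t * echar (- (of_int t * y)))"
        unfolding b_def times_divide_eq_left sum_divide_distrib[symmetric] .
    qed
    show "b 0 = of_real a" using \<beta>_pos by (simp add: b_def a_def \<beta>(1))
    show "cmod (b t) \<le> a" if "\<bar>t\<bar> \<le> int (k * M)" for t
    proof -
      have "cmod (\<Sum>j<W. B t * echar (- (of_int t * (of_nat j / of_nat P)))) \<le> (\<Sum>j<W. \<beta>)"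
        by (rule sum_norm_le) (simp add: norm_mult \<beta>(2)[OF that])
      then have "cmod (b t) \<le> (\<Sum>j<W. \<beta>) / (of_nat P * \<beta>)"
        using \<beta>_pos P0 unfolding b_def norm_divide norm_of_real by (intro frac_le) auto
      also have "\<dots> = a" using \<beta>_pos by (simp add: a_def)
      finally show ?thesis .
    qed
    show "\<delta> / 2 \<le> a" using W P0 by (simp add: a_def field_simps)
    show "0 \<le> f y" for y using \<beta>_pos by (simp add: f_def F0 sum_nonneg)
    show "f y \<le> 1" for y
    proof -
      have "(\<Sum>j<W. F (y + of_nat j / of_nat P)) \<le> (\<Sum>j<P. F (y + of_nat j / of_nat P))"
        by (rule sum_mono2) (use WP F0 in auto)
      then show ?thesis using \<beta>(3)[OF P, of y] \<beta>_pos P0 by (simp add: f_def)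
    qed
    show "f y \<le> 8 * (\<delta> * M) * (16 / (\<delta> * M)\<^sup>2) ^ k" if y: "\<And>r::int. \<delta> < \<bar>y - of_int r\<bar>" for y
    proof -
      \<comment> \<open>A shift of at most \<open>\<delta>/2\<close> leaves the point at distance at
        least \<open>\<delta>/2\<close> from the integers, so |D| is at most
        \<open>2 / \<delta>\<close> there.\<close>
      have "F (y + of_nat j / of_nat P) \<le> ((2 / \<delta>)\<^sup>2) ^ k" if "j < W" for j
      proof -
        have "real j \<le> \<delta> * P / 2" using that W(2) by linarith
        then have j: "real j / real P \<le> \<delta> / 2" using P0 by (simp add: field_simps)
        have "cmod (dirichlet M (y + of_nat j / of_nat P)) \<le> 1 / (\<delta> / 2)"
        proof (rule dirichlet_le)
          show "\<delta> / 2 \<le> \<bar>y + real j / real P - of_int r\<bar>" for r :: int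
          proof -
            have "0 \<le> real j / real P" by simp
            then show ?thesis using j y[of r] by linarith
          qed
        qed (use \<delta> in auto)
        then show ?thesis unfolding F_def by (intro power_mono) auto
      qed
      then have "(\<Sum>j<W. F (y + of_nat j / of_nat P)) \<le> real W * ((2 / \<delta>)\<^sup>2) ^ k"
        using sum_bounded_above[of "{..<W}" "\<lambda>j. F (y + of_nat j / of_nat P)"] by simp
      also have "\<dots> \<le> \<delta> * P * ((2 / \<delta>)\<^sup>2) ^ k" by (rule mult_right_mono[OF W']) simp
      finally have "f y \<le> \<delta> * P * ((2 / \<delta>)\<^sup>2) ^ k / (P * \<beta>)"
        unfolding f_def using \<beta>_pos by (intro divide_right_mono) auto
      also have "\<dots> = \<delta> * ((2 / \<delta>)\<^sup>2) ^ k / \<beta>" using P0 by simp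
      also have "\<dots> \<le> \<delta> * ((2 / \<delta>)\<^sup>2) ^ k / (((real M / 2)\<^sup>2) ^ k / (8 * M))"
        using \<beta>_ge M \<delta> by (intro divide_left_mono) (auto simp: field_simps \<beta>_pos)
      also have "\<dots> = 8 * (\<delta> * M) * ((2 / \<delta>)\<^sup>2 / (real M / 2)\<^sup>2) ^ k"
      proof -
        have "d * u / (v / (8 * w)) = 8 * (d * w) * (u / v)" for d u v w :: real by simp
        then show ?thesis by (simp only: power_divide[of "(2 / \<delta>)\<^sup>2"] of_nat_mult of_nat_numeral)
      qed
      also have "(2 / \<delta>)\<^sup>2 / (real M / 2)\<^sup>2 = 16 / (\<delta> * M)\<^sup>2"
        by (simp add: power_divide power_mult_distrib)
      finally show ?thesis .
    qed
  qed
qed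

section \<open>The two bounds for the measure\<close>

lemma integrable_prod_phase:
  fixes \<mu> :: "(real ^ 'n ^ 'm) measure"
  assumes "prob_space \<mu>" and [measurable_cong]: "sets \<mu> = sets borel"
    and F: "has_spectrum (\<lambda>y. of_real (f y)) d b"
  shows "integrable \<mu> (\<lambda>x. \<Prod>i\<in>UNIV. f (phase q \<theta> x i))"
proof -
  interpret prob_space \<mu> by fact
  have f: "f y = Re (\<Sum>t\<in>{- int d..int d}. b t * echar (- (of_int t * y)))" for y
    using has_spectrumD[OF F, of y] by (metis Re_complex_of_real)
  then have "f = (\<lambda>y. Re (\<Sum>t\<in>{- int d..int d}. b t * echar (- (of_int t * y))))" by auto
  then have "continuous_on UNIV f" by (simp only:) (intro continuous_intros)
  then have [measurable]: "f \<in> borel_measurable borel" by (rule borel_measurable_continuous_onI)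
  define A where "A = (\<Sum>t\<in>{- int d..int d}. cmod (b t))"
  have "\<bar>f y\<bar> \<le> A" for y
    unfolding f A_def by (rule order.trans[OF abs_Re_le_cmod], rule sum_norm_le) (simp add: norm_mult)
  then have "(\<Prod>i\<in>UNIV. \<bar>f (phase q \<theta> x i)\<bar>) \<le> (\<Prod>i\<in>(UNIV :: 'm set). A)" for x
    by (intro prod_mono) auto
  then show ?thesis
    by (intro integrable_const_bound[where B = "A ^ CARD('m)"]) (auto simp: abs_prod)
qed

text \<open>A Markov argument: on \<open>Lm \<delta> q \<theta>\<close> each of the m factors |D|^2
  is at least (M/2)^2, while the integral of their product is at most M^m (1 + S). The quotient is
  (4/M)^m (1 + S), and 1/M is at most \<open>16 * \<delta>\<close>.\<close>

lemma measure_Lm_le: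
  fixes \<mu> :: "(real ^ 'n ^ 'm) measure"
  assumes \<delta>: "0 < \<delta>" "\<delta> < 1/2" and \<mu>: "prob_space \<mu>" "sets \<mu> = sets borel"
  shows "measure \<mu> (Lm \<delta> q \<theta>) \<le> 64 ^ CARD('m) * \<delta> ^ CARD('m) *
    (1 + (\<Sum>t\<in>freqs (2 / \<delta>). cmod (fourier \<mu> (outer t q))))"
proof -
  interpret prob_space \<mu> by fact
  define S where "S = (\<Sum>t\<in>freqs (2 / \<delta>). cmod (fourier \<mu> (outer t q)))"
  \<comment> \<open>The largest M for which \<open>dirichlet_ge\<close> applies at distance
    \<open>\<delta>\<close>, replaced by 1 when \<open>\<delta>\<close> > 1/8. In both cases
    \<open>1 / (8 * \<delta>)\<close> <= 2M, and the degree M stays below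
    \<open>2 / \<delta>\<close>.\<close>
  define M where "M = max 1 (nat \<lfloor>1 / (8 * \<delta>)\<rfloor>)"
  have M: "1 \<le> M" "real M * \<delta> \<le> 1/8 \<or> M \<le> 1" "real M * \<delta> \<le> 2" "1 \<le> 16 * \<delta> * M"
  proof -
    show "1 \<le> M" by (simp add: M_def)
    show *: "real M * \<delta> \<le> 1/8 \<or> M \<le> 1"
    proof (cases "M \<le> 1")
      case False
      then have "real M \<le> 1 / (8 * \<delta>)" using \<delta> by (auto simp: M_def max_def split: if_splits)
      then show ?thesis using \<delta> by (simp add: field_simps)
    qed simp
    show "real M * \<delta> \<le> 2" using * \<delta> \<open>1 \<le> M\<close> by (cases "M = 1") auto
    have "1 / (8 * \<delta>) \<le> 2 * real M" unfolding M_def by linarith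
    then show "1 \<le> 16 * \<delta> * M" using \<delta> by (simp add: field_simps)
  qed
  define f where "f y = (cmod (dirichlet M y))\<^sup>2" for y
  have f0: "0 \<le> f y" for y by (simp add: f_def)
  obtain b where b: "has_spectrum (\<lambda>y. of_real (f y)) M b" "b 0 = of_nat M"
    unfolding f_def by (rule has_spectrum_fejer)
  obtain a where a: "b 0 = of_real a" "\<And>t. \<bar>t\<bar> \<le> int M \<Longrightarrow> cmod (b t) \<le> a"
    using spectrum_nonneg[OF b(1) f0] by metis
  have aM: "a = M" using a(1) b(2) by (metis of_real_eq_iff of_real_of_nat_eq)
  have int: "integrable \<mu> (\<lambda>x. \<Prod>i\<in>UNIV. f (phase q \<theta> x i))"
    by (rule integrable_prod_phase[OF \<mu> b(1)])
  have "\<bar>(LINT x|\<mu>. (\<Prod>i\<in>UNIV. f (phase q \<theta> x i))) - a ^ CARD('m)\<bar> \<le> a ^ CARD('m) * S"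
    unfolding S_def
    by (rule integral_prod_approx[OF \<mu> b(1) a]) (use \<delta> M in \<open>auto simp: field_simps\<close>)
  then have up: "(LINT x|\<mu>. (\<Prod>i\<in>UNIV. f (phase q \<theta> x i))) \<le> real M ^ CARD('m) * (1 + S)"
    by (simp add: aM algebra_simps abs_le_iff)
  have Lm: "Lm \<delta> q \<theta> \<in> sets \<mu>" using Lm_borel \<mu> by auto
  have "((M / 2)\<^sup>2) ^ CARD('m) * measure \<mu> (Lm \<delta> q \<theta>)
      = (LINT x|\<mu>. ((M / 2)\<^sup>2) ^ CARD('m) * indicator (Lm \<delta> q \<theta>) x)"
    using Lm by simp
  also have "\<dots> \<le> (LINT x|\<mu>. (\<Prod>i\<in>UNIV. f (phase q \<theta> x i)))"
  proof (rule integral_mono[OF _ int])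
    show "integrable \<mu> (\<lambda>x. ((M / 2)\<^sup>2) ^ CARD('m) * indicator (Lm \<delta> q \<theta>) x :: real)"
      using Lm by (intro integrable_mult_right integrable_real_indicator) (auto simp: less_top[symmetric])
    fix x
    show "((M / 2)\<^sup>2) ^ CARD('m) * indicator (Lm \<delta> q \<theta>) x \<le> (\<Prod>i\<in>UNIV. f (phase q \<theta> x i))"
    proof (cases "x \<in> Lm \<delta> q \<theta>")
      case True
      have "(M / 2)\<^sup>2 \<le> f (phase q \<theta> x i)" for i
      proof -
        obtain r :: int where "\<bar>phase q \<theta> x i - of_int r\<bar> \<le> \<delta>" using True by (auto simp: mem_Lm_iff)
        then show ?thesis unfolding f_def using dirichlet_ge[OF _ M(2)] by (intro power_mono) auto
      qed
      then have "(\<Prod>i\<in>(UNIV :: 'm set). (M / 2)\<^sup>2) \<le> (\<Prod>i\<in>UNIV. f (phase q \<theta> x i))"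
        by (intro prod_mono) auto
      then show ?thesis using True by simp
    qed (simp add: f0 prod_nonneg)
  qed
  also note up
  finally have "measure \<mu> (Lm \<delta> q \<theta>) \<le> real M ^ CARD('m) * (1 + S) / ((M / 2)\<^sup>2) ^ CARD('m)"
    using M by (simp add: pos_le_divide_eq mult.commute)
  also have "\<dots> = (M / (M / 2)\<^sup>2) ^ CARD('m) * (1 + S)" by (simp add: power_divide)
  also have "M / (M / 2)\<^sup>2 = 4 / M" using M by (simp add: power2_eq_square)
  also have "(4 / M) ^ CARD('m) * (1 + S) \<le> (64 * \<delta>) ^ CARD('m) * (1 + S)"
  proof (intro mult_right_mono power_mono)
    show "4 / real M \<le> 64 * \<delta>" using M by (simp add: field_simps)
    show "0 \<le> 1 + S" by (simp add: S_def sum_nonneg)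
  qed simp
  finally show ?thesis by (simp add: S_def power_mult_distrib)
qed

text \<open>The product of f over the phases is at most the indicator of
  \<open>Lm \<delta> q \<theta>\<close> plus \<epsilon>: outside the set some phase is far from the
  integers and gives a factor at most \<epsilon>, the other factors being at most 1.\<close>

lemma measure_Lm_ge:
  fixes \<mu> :: "(real ^ 'n ^ 'm) measure"
  assumes \<delta>: "0 < \<delta>" "\<delta> < 1" and \<mu>: "prob_space \<mu>" "sets \<mu> = sets borel"
    and k: "1 \<le> k" and K: "real k \<le> K"
  shows "(1 / 2) ^ CARD('m) * \<delta> ^ CARD('m) *
      (1 - (\<Sum>t\<in>freqs (K / \<delta>). cmod (fourier \<mu> (outer t q)))) - 8 * 16 ^ k * (2 * k / K) ^ (2 * k - 1)
    \<le> measure \<mu> (Lm \<delta> q \<theta>)"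
proof -
  interpret prob_space \<mu> by fact
  define S where "S = (\<Sum>t\<in>freqs (K / \<delta>). cmod (fourier \<mu> (outer t q)))"
  \<comment> \<open>M is the largest integer with kM <= \<open>K / \<delta>\<close>. Since K >= k
    forces x >= 1, rounding down loses at most a factor 2, so \<open>\<delta> * M\<close> >=
    K/(2k).\<close>
  define x where "x = K / (k * \<delta>)"
  define M where "M = nat \<lfloor>x\<rfloor>"
  define \<epsilon> where "\<epsilon> = 8 * (\<delta> * M) * (16 / (\<delta> * M)\<^sup>2) ^ k"
  have "k * \<delta> \<le> K" using K k \<delta> mult_left_mono[of \<delta> 1 "real k"] by linarith
  then have x: "1 \<le> x" unfolding x_def using \<delta> k by (simp add: field_simps)
  then have "real M = \<lfloor>x\<rfloor>" by (simp add: M_def)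
  then have "real M \<le> x" "1 \<le> M" "x < real M + 1" using x by linarith+
  then have "real M \<le> x" "1 \<le> M" "x \<le> 2 * real M" by linarith+
  then have M: "1 \<le> M" "K / (2 * k) \<le> \<delta> * M" "real (k * M) \<le> K / \<delta>"
    using \<delta> k unfolding x_def by (simp_all add: field_simps)
  have K0: "0 < K" using k K by linarith
  obtain f b a where f: "has_spectrum (\<lambda>y. of_real (f y)) (k * M) b" "b 0 = of_real a"
    "\<And>t. \<bar>t\<bar> \<le> int (k * M) \<Longrightarrow> cmod (b t) \<le> a" "\<delta> / 2 \<le> a"
    "\<And>y. 0 \<le> f y" "\<And>y. f y \<le> 1" "\<And>y. (\<And>r::int. \<delta> < \<bar>y - of_int r\<bar>) \<Longrightarrow> f y \<le> \<epsilon>"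
    unfolding \<epsilon>_def using smoothed_interval[OF \<delta> M(1), of k thesis] by blast
  have \<epsilon>0: "0 \<le> \<epsilon>" using \<delta> by (simp add: \<epsilon>_def)
  have Lm: "Lm \<delta> q \<theta> \<in> sets \<mu>" using Lm_borel \<mu> by auto
  have int: "integrable \<mu> (\<lambda>x. \<Prod>i\<in>UNIV. f (phase q \<theta> x i))"
    by (rule integrable_prod_phase[OF \<mu> f(1)])
  have "\<bar>(LINT x|\<mu>. (\<Prod>i\<in>UNIV. f (phase q \<theta> x i))) - a ^ CARD('m)\<bar> \<le> a ^ CARD('m) * S"
    unfolding S_def by (rule integral_prod_approx[OF \<mu> f(1-3) M(3)])
  then have "a ^ CARD('m) * (1 - S) \<le> (LINT x|\<mu>. (\<Prod>i\<in>UNIV. f (phase q \<theta> x i)))"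
    by (simp add: algebra_simps abs_le_iff)
  also have "\<dots> \<le> (LINT x|\<mu>. indicator (Lm \<delta> q \<theta>) x + \<epsilon>)"
  proof (rule integral_mono[OF int])
    show "integrable \<mu> (\<lambda>x. indicator (Lm \<delta> q \<theta>) x + \<epsilon>)"
      using Lm by (intro Bochner_Integration.integrable_add integrable_real_indicator) (auto simp: less_top[symmetric])
    fix x
    show "(\<Prod>i\<in>UNIV. f (phase q \<theta> x i)) \<le> indicator (Lm \<delta> q \<theta>) x + \<epsilon>"
    proof (cases "x \<in> Lm \<delta> q \<theta>")
      case True
      have "(\<Prod>i\<in>UNIV. f (phase q \<theta> x i)) \<le> 1" by (rule prod_le_1) (simp add: f)
      then show ?thesis using True \<epsilon>0 by simp
    next
      case False
      then obtain i where i: "\<And>r::int. \<delta> < \<bar>phase q \<theta> x i - of_int r\<bar>"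
        by (auto simp: mem_Lm_iff not_le)
      have "(\<Prod>i\<in>UNIV. f (phase q \<theta> x i)) = f (phase q \<theta> x i) * (\<Prod>j\<in>UNIV - {i}. f (phase q \<theta> x j))"
        by (rule prod.remove) auto
      also have "\<dots> \<le> \<epsilon> * 1"
        by (intro mult_mono f(7)[OF i] prod_le_1 prod_nonneg) (auto simp: f \<epsilon>0)
      finally show ?thesis using False by simp
    qed
  qed
  also have "\<dots> = measure \<mu> (Lm \<delta> q \<theta>) + \<epsilon>"
    using Lm by (subst Bochner_Integration.integral_add)
      (auto simp: prob_space less_top[symmetric] intro!: integrable_real_indicator)
  finally have main: "a ^ CARD('m) * (1 - S) \<le> measure \<mu> (Lm \<delta> q \<theta>) + \<epsilon>" .
  \<comment> \<open>Replacing a by its lower bound \<open>\<delta>/2\<close> is legitimate only if 1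
    - S >= 0; otherwise the left side is nonpositive and there is nothing to prove.\<close>
  have low: "(\<delta> / 2) ^ CARD('m) * (1 - S) \<le> measure \<mu> (Lm \<delta> q \<theta>) + \<epsilon>"
  proof (cases "S \<le> 1")
    case True
    then have "(\<delta> / 2) ^ CARD('m) * (1 - S) \<le> a ^ CARD('m) * (1 - S)"
      using \<delta> f(4) by (intro mult_right_mono power_mono) auto
    then show ?thesis using main by linarith
  next
    case False
    then have "(\<delta> / 2) ^ CARD('m) * (1 - S) \<le> 0"
      using \<delta> by (intro mult_nonneg_nonpos) auto
    also have "0 \<le> measure \<mu> (Lm \<delta> q \<theta>) + \<epsilon>" using \<epsilon>0 by simp
    finally show ?thesis .
  qed
  \<comment> \<open>The factor \<open>\<delta> * M\<close> in \<epsilon>, which came from the window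
    length and the bound for \<beta>, cancels one of the 2k inverse powers.\<close>
  have "\<epsilon> \<le> 8 * 16 ^ k * (2 * k / K) ^ (2 * k - 1)"
  proof -
    have pos: "0 < \<delta> * M" using \<delta> M by simp
    have "\<epsilon> = 8 * 16 ^ k * ((\<delta> * M) * (1 / (\<delta> * M)) ^ (2 * k))"
      by (simp add: \<epsilon>_def power_divide power_mult)
    also have "(1 / (\<delta> * M)) ^ (2 * k) = (1 / (\<delta> * M)) ^ (2 * k - 1) * (1 / (\<delta> * M))"
      using k by (metis One_nat_def Suc_pred' mult_2 power_Suc2 trans_less_add1 zero_less_one order_less_le_trans)
    also have "(\<delta> * M) * ((1 / (\<delta> * M)) ^ (2 * k - 1) * (1 / (\<delta> * M))) = (1 / (\<delta> * M)) ^ (2 * k - 1)"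
    proof -
      have "z * (w * (1 / z)) = w" if "0 < z" for z w :: real using that by simp
      then show ?thesis using pos by blast
    qed
    also have "\<dots> \<le> (2 * k / K) ^ (2 * k - 1)"
      using M(2) pos K0 k by (intro power_mono) (auto simp: field_simps)
    finally show ?thesis by simp
  qed
  with low show ?thesis by (simp add: S_def power_divide)
qed

section \<open>Choice of the constants\<close>

theorem lemma3p1p1:
  shows "\<exists>C1>0. \<exists>C2>0. \<exists>c>0. \<exists>C3>0. \<exists>CN :: real \<Rightarrow> real. (\<forall>N>0. CN N > 0) \<and>
    (\<forall>(\<theta> :: real ^ 'm) (q :: int ^ 'n) (\<delta> :: real) (\<mu> :: (real ^ 'n ^ 'm) measure).
      q \<noteq> 0 \<longrightarrow> 0 < \<delta> \<longrightarrow> \<delta> < 1 / 2 \<longrightarrow> prob_on_unit_cube \<mu> \<longrightarrow>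
        measure \<mu> (Lm \<delta> q \<theta>)
          \<le> C1 * \<delta> ^ CARD('m) * (1 + C2 * (\<Sum>t\<in>freqs (2 / \<delta>). cmod (fourier \<mu> (outer t q)))) \<and>
        (\<forall>K>0. \<forall>N>0.
          measure \<mu> (Lm \<delta> q \<theta>)
            \<ge> c * \<delta> ^ CARD('m) * (1 - C3 * (\<Sum>t\<in>freqs (K / \<delta>). cmod (fourier \<mu> (outer t q))))
               - CN N * K powr (- N)))"
proof -
  \<comment> \<open>For N > 0 this gives k >= 1 and 2k - 1 >= k >= N, so the decay exponent 2k - 1
    suffices. \<open>CN N\<close> is the error term of \<open>measure_Lm_ge\<close> without its
    factor K^(-(2k-1)).\<close>
  define k :: "real \<Rightarrow> nat" where "k N = nat \<lceil>N\<rceil>" for N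
  define CN :: "real \<Rightarrow> real" where "CN N = 8 * 16 ^ k N * (2 * k N) ^ (2 * k N - 1)" for N
  have k: "1 \<le> k N" "N \<le> k N" if "0 < N" for N
    using that unfolding k_def by linarith+
  have lower: "(1 / 2) ^ CARD('m) * \<delta> ^ CARD('m) * (1 - 1 * (\<Sum>t\<in>freqs (K / \<delta>). cmod (fourier \<mu> (outer t q))))
      - CN N * K powr (- N) \<le> measure \<mu> (Lm \<delta> q \<theta>)"
    if \<delta>: "0 < \<delta>" "\<delta> < 1/2" and \<mu>: "prob_space \<mu>" "sets \<mu> = sets borel" and K: "0 < K" and N: "0 < N"
    for \<theta> :: "real ^ 'm" and q :: "int ^ 'n" and \<delta> \<mu> K N
  proof -
    define S where "S = (\<Sum>t\<in>freqs (K / \<delta>). cmod (fourier \<mu> (outer t q)))"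
    note k = k[OF N]
    have e: "k N \<le> 2 * k N - 1" using k by linarith
    show ?thesis
    \<comment> \<open>For K >= k the previous lemma applies, and K >= 1 allows lowering the exponent
      from 2k - 1 to N. For K < k the claim is trivial: the main term is at most 1 and the
      subtracted error is at least 1.\<close>
    proof (cases "k N \<le> K")
      case True
      then have K1: "1 \<le> K" using k by linarith
      have "(1 / K) ^ (2 * k N - 1) = K powr - real (2 * k N - 1)"
        using K by (simp add: powr_minus powr_realpow power_one_over inverse_eq_divide)
      also have "\<dots> \<le> K powr - N"
        using K1 k e by (intro powr_mono) linarith+
      finally have *: "(1 / K) ^ (2 * k N - 1) \<le> K powr - N" .
      have "8 * 16 ^ k N * (2 * k N / K) ^ (2 * k N - 1) = CN N * (1 / K) ^ (2 * k N - 1)"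
        by (simp add: CN_def power_divide)
      also have "\<dots> \<le> CN N * K powr - N"
        by (rule mult_left_mono[OF *]) (simp add: CN_def)
      finally have "8 * 16 ^ k N * (2 * k N / K) ^ (2 * k N - 1) \<le> CN N * K powr - N" .
      then show ?thesis
        using measure_Lm_ge[OF \<delta>(1) _ \<mu> k(1) True, of q \<theta>] \<delta> by simp
    next
      case False
      have "0 \<le> S" by (simp add: S_def sum_nonneg)
      then have "(\<delta> / 2) ^ CARD('m) * (1 - S) \<le> (\<delta> / 2) ^ CARD('m) * 1"
        using \<delta> by (intro mult_left_mono) auto
      also have "\<dots> \<le> 1" using \<delta> by (simp add: power_le_one)
      finally have "(\<delta> / 2) ^ CARD('m) * (1 - S) \<le> 1" .
      \<comment> \<open>This is K^N <= (2k)^N <= (2k)^(2k-1) <= \<open>CN N\<close>.\<close>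
      moreover have "1 \<le> CN N * K powr - N"
      proof -
        have "K powr N \<le> (2 * k N) powr N"
          using False K N by (intro powr_mono2) auto
        also have "\<dots> \<le> (2 * k N) powr real (2 * k N - 1)"
          using k e by (intro powr_mono) linarith+
        also have "\<dots> = (2 * k N) ^ (2 * k N - 1)" unfolding of_nat_power by (rule powr_realpow) (use k in simp)
        also have "\<dots> \<le> CN N"
        proof -
          have "1 \<le> 8 * (16::nat) ^ k N" by (simp add: Suc_leI)
          from mult_le_mono1[OF this, of "(2 * k N) ^ (2 * k N - 1)"]
          show ?thesis unfolding CN_def of_nat_le_iff by (simp only: mult_1)
        qed
        finally show ?thesis using K by (simp add: powr_minus field_simps)
      qed
      ultimately have "(\<delta> / 2) ^ CARD('m) * (1 - S) - CN N * K powr - N \<le> 0" by linarith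
      also have "0 \<le> measure \<mu> (Lm \<delta> q \<theta>)" by simp
      finally show ?thesis by (simp add: S_def power_divide)
    qed
  qed
  show ?thesis
  proof (rule exI[of _ "64 ^ CARD('m)"], rule conjI[rotated], rule exI[of _ 1], rule conjI[rotated],
      rule exI[of _ "(1/2) ^ CARD('m)"], rule conjI[rotated], rule exI[of _ 1], rule conjI[rotated],
      rule exI[of _ CN], intro conjI allI impI)
    show "CN N > 0" if "N > 0" for N using k[OF that] by (simp add: CN_def)
    fix \<theta> :: "real ^ 'm" and q :: "int ^ 'n" and \<delta> :: real and \<mu> :: "(real ^ 'n ^ 'm) measure"
    assume \<delta>: "0 < \<delta>" "\<delta> < 1 / 2" and "prob_on_unit_cube \<mu>"
    then have \<mu>: "prob_space \<mu>" "sets \<mu> = sets borel" by (simp_all add: prob_on_unit_cube_def)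
    show "measure \<mu> (Lm \<delta> q \<theta>) \<le> 64 ^ CARD('m) * \<delta> ^ CARD('m) *
        (1 + 1 * (\<Sum>t\<in>freqs (2 / \<delta>). cmod (fourier \<mu> (outer t q))))"
      using measure_Lm_le[OF \<delta> \<mu>, of q \<theta>] by (simp only: mult_1)
    show "(1/2) ^ CARD('m) * \<delta> ^ CARD('m) * (1 - 1 * (\<Sum>t\<in>freqs (K / \<delta>). cmod (fourier \<mu> (outer t q))))
        - CN N * K powr (- N) \<le> measure \<mu> (Lm \<delta> q \<theta>)" if "0 < K" "0 < N" for K N
      by (rule lower[OF \<delta> \<mu> that])
  qed simp_all
qed

end
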